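(* Let $G$ be a graph of size $n$ and let $K\ge\Delta$ be an upper bound on the maximum degree $\Delta$ of $G$, known to all nodes. Then the algorithm described in the context computes a $(K+1)$-colouring of $G$ (a proper colouring with colours in $\{0,\dots,K\}$) within $O(K\log n)$ phases with probability $1-o(n^{-1})$.
   Context: Beeping model: the network is an undirected graph $G=(V,E)$; nodes are anonymous, all run the same randomised algorithm with independent random choices, and all start in the same slot. Time is divided into synchronous slots; in each slot every active node either beeps or listens. In the model $B_{cd}L$, a beeping node learns whether at least one neighbour beeped in the same slot, and a listening node learns only whether at least one neighbour beeped. Algorithm in $B_{cd}L$ (each node knows $K$). Each node maintains a set $Colours$, initially $\{0,\dots,K\}$, a colour, initially undefined, a beeping probability $p$, and a counter, initially $0$, which is incremented modulo $K+1$ at the end of every phase. Each phase consists of two slots. A cycle is a sequence of $K+1$ consecutive phases (in which the counter runs through $0,\dots,K$). At the beginning of each cycle, every uncoloured node sets $p=1/(2|Colours|)$, where $|Colours|$ is the number of colours currently remaining in its set; $p$ is kept fixed during the cycle. In a phase with counter value $c$, an uncoloured node with $c\notin Colours$ stays idle. An uncoloured node with $c\in Colours$ beeps in slot 1 with probability $p$; if it beeped and none of its neighbours beeped in slot 1, it takes $c$ as its colour, beeps in slot 2 (confirmation), and terminates. An uncoloured node that hears a beep in slot 2 removes $c$ from its set $Colours$. *)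

theory Defs
  imports
    "HOL-Probability.Probability"
    "HOL-Library.Landau_Symbols"
    "Graph_Theory.Pair_Digraph"
begin

section \<open>Graphs and colourings\<close>

text \<open>
  A finite simple undirected graph is a \<^locale>\<open>pair_graph\<close>: a finite loopless digraph whose
  arc set is symmetric, so each undirected edge is represented by its two orientations and the
  degree of a vertex is its out-degree.  The inserted \<open>0\<close> only matters for the graph
  without vertices.
\<close>

definition max_degree :: "'v pair_pre_digraph \<Rightarrow> nat" where
  "max_degree G = Max (insert 0 (out_degree (with_proj G) ` pverts G))"

definition proper_colouring :: "'v pair_pre_digraph \<Rightarrow> nat set \<Rightarrow> ('v \<Rightarrow> nat) \<Rightarrow> bool" where
  "proper_colouring G C f \<longleftrightarrow>
     (\<forall>v\<in>pverts G. f v \<in> C) \<and> (\<forall>(v, w)\<in>parcs G. f v \<noteq> f w)"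

section \<open>The beeping model with collision detection for beeping nodes\<close>

datatype action = Beep | Listen

text \<open>
  All nodes run the same algorithm from the same initial local state.  In every slot an active
  node chooses its action at random depending only on its local state, and then updates that
  state.  The Boolean argument of \<open>update\<close> says whether at least one neighbour beeped in
  the slot; this is exactly what both a beeping and a listening node learn.
\<close>

record 's beeping_algorithm =
  initial :: 's
  active :: "'s \<Rightarrow> bool"
  choice :: "'s \<Rightarrow> action pmf"
  update :: "'s \<Rightarrow> action \<Rightarrow> bool \<Rightarrow> 's"

definition neighbour_beeps :: "'v pair_pre_digraph \<Rightarrow> ('v \<Rightarrow> action) \<Rightarrow> 'v \<Rightarrow> bool" where
  "neighbour_beeps G a v \<longleftrightarrow> (\<exists>w. (v, w) \<in> parcs G \<and> a w = Beep)"

text \<open>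
  Inactive nodes never beep and keep their state.  The product distribution makes the choices of
  the nodes in a slot independent given the current global state.
\<close>

definition slot_step ::
  "'v pair_pre_digraph \<Rightarrow> 's beeping_algorithm \<Rightarrow> ('v \<Rightarrow> 's) \<Rightarrow> ('v \<Rightarrow> 's) pmf" where
  "slot_step G A \<sigma> =
     map_pmf
       (\<lambda>a v. if v \<in> pverts G \<and> active A (\<sigma> v)
              then update A (\<sigma> v) (a v) (neighbour_beeps G a v) else \<sigma> v)
       (Pi_pmf (pverts G) Listen
         (\<lambda>v. if active A (\<sigma> v) then choice A (\<sigma> v) else return_pmf Listen))"

primrec run_slots ::
  "'v pair_pre_digraph \<Rightarrow> 's beeping_algorithm \<Rightarrow> nat \<Rightarrow> ('v \<Rightarrow> 's) pmf" where
  "run_slots G A 0 = return_pmf (\<lambda>_. initial A)"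
| "run_slots G A (Suc t) = bind_pmf (run_slots G A t) (slot_step G A)"

section \<open>The colouring algorithm\<close>

datatype phase_slot = Slot1 | Slot2

record node_state =
  colours :: "nat set"
  colour :: "nat option"
  beep_prob :: real
  counter :: nat
  phase_slot :: phase_slot
  terminated :: bool

text \<open>The counter value \<open>0\<close> marks the first phase of a cycle.\<close>

definition begin_phase :: "node_state \<Rightarrow> node_state" where
  "begin_phase s =
     (if counter s = 0 then s\<lparr>beep_prob := 1 / (2 * real (card (colours s)))\<rparr> else s)"

definition initial_state :: "nat \<Rightarrow> node_state" where
  "initial_state K = begin_phase
     \<lparr>colours = {0..K}, colour = None, beep_prob = 0, counter = 0,
      phase_slot = Slot1, terminated = False\<rparr>"

text \<open>
  An idle node is modelled as a listening one: whatever it hears in a phase whose counter value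
  is not in its set of colours has no effect on it.  In slot 2 the nodes with a defined colour
  are those that took it in slot 1 of the same phase, because they terminate after confirming.
\<close>

definition node_choice :: "node_state \<Rightarrow> action pmf" where
  "node_choice s =
     (case phase_slot s of
        Slot1 \<Rightarrow>
          if counter s \<in> colours s
          then map_pmf (\<lambda>b. if b then Beep else Listen) (bernoulli_pmf (beep_prob s))
          else return_pmf Listen
      | Slot2 \<Rightarrow> return_pmf (if colour s \<noteq> None then Beep else Listen))"

definition update_state :: "nat \<Rightarrow> node_state \<Rightarrow> action \<Rightarrow> bool \<Rightarrow> node_state" where
  "update_state K s a heard =
     (case phase_slot s of
        Slot1 \<Rightarrow>
          s\<lparr>colour := (if a = Beep \<and> \<not> heard then Some (counter s) else None),
            phase_slot := Slot2\<rparr>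
      | Slot2 \<Rightarrow>
          if colour s \<noteq> None then s\<lparr>terminated := True\<rparr>
          else begin_phase
            (s\<lparr>colours := (if heard then colours s - {counter s} else colours s),
               counter := (counter s + 1) mod (K + 1),
               phase_slot := Slot1\<rparr>))"

definition colouring_algorithm :: "nat \<Rightarrow> node_state beeping_algorithm" where
  "colouring_algorithm K =
     \<lparr>initial = initial_state K, active = (\<lambda>s. \<not> terminated s),
      choice = node_choice, update = update_state K\<rparr>"

text \<open>Each phase consists of two slots.\<close>

definition run_phases :: "'v pair_pre_digraph \<Rightarrow> nat \<Rightarrow> nat \<Rightarrow> ('v \<Rightarrow> node_state) pmf" where
  "run_phases G K T = run_slots G (colouring_algorithm K) (2 * T)"

definition colouring_computed ::
  "'v pair_pre_digraph \<Rightarrow> nat \<Rightarrow> ('v \<Rightarrow> node_state) \<Rightarrow> bool" where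
  "colouring_computed G K \<sigma> \<longleftrightarrow>
     (\<forall>v\<in>pverts G. terminated (\<sigma> v) \<and> colour (\<sigma> v) \<noteq> None) \<and>
     proper_colouring G {0..K} (\<lambda>v. the (colour (\<sigma> v)))"

end

theory Submission
  imports Defs
begin

text \<open>
  An active node always has more remaining colours than active neighbours, since a phase that
  deletes a colour also terminates a neighbour.  An active neighbour \<open>w\<close> of \<open>v\<close> beeps with
  probability \<open>1 / (2 |Colours w|)\<close> for each of its colours, so over a whole cycle it contributes
  a total beeping probability of at most \<open>1 / 2\<close>.  Hence the neighbours of \<open>v\<close> contribute at
  most \<open>|Colours v| / 2\<close>, and the probabilities that \<open>v\<close> beeps alone in the phases of the cycle
  add up to at least \<open>1 / 4\<close>.  So \<open>v\<close> survives a cycle with probability at most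
  \<open>exp (- 1 / 4)\<close>, independently of \<open>K\<close> and of the past; a union bound over the nodes after
  about \<open>16 ln n\<close> cycles gives failure probability \<open>O(n\<^sup>-\<^sup>3)\<close>.
\<close>

section \<open>Conditioning on an intermediate state\<close>

text \<open>Serves to multiply survival bounds of consecutive blocks of phases. \<open>A\<close> is
  survival of the first block, outside which later survival is impossible, and \<open>b\<close>
  bounds the rest uniformly over all surviving states, so the past enters only through the current
  state.\<close>

lemma prob_bind_le:
  assumes "\<And>x. x \<in> set_pmf M \<Longrightarrow> x \<in> A \<Longrightarrow> measure_pmf.prob (f x) S \<le> b"
    and "\<And>x. x \<in> set_pmf M \<Longrightarrow> x \<notin> A \<Longrightarrow> measure_pmf.prob (f x) S = 0"
    and "0 \<le> b"
  shows "measure_pmf.prob (bind_pmf M f) S \<le> measure_pmf.prob M A * b"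
proof -
  have "emeasure (bind_pmf M f) S = (\<integral>\<^sup>+x. emeasure (f x) S \<partial>M)"
    by simp
  also have "\<dots> \<le> (\<integral>\<^sup>+x. ennreal b * indicator A x \<partial>M)"
    using assms
    by (intro nn_integral_mono_AE)
      (auto simp: AE_measure_pmf_iff indicator_def measure_pmf.emeasure_eq_measure intro!: ennreal_leI)
  also have "\<dots> = ennreal (measure_pmf.prob M A * b)"
    using assms(3)
    by (simp add: nn_integral_cmult measure_pmf.emeasure_eq_measure ennreal_mult' mult.commute)
  finally show ?thesis
    using assms(3) by (simp add: measure_pmf.emeasure_eq_measure)
qed

lemma begin_phase_simps [simp]:
  "colours (begin_phase s) = colours s"
  "colour (begin_phase s) = colour s"
  "counter (begin_phase s) = counter s"
  "phase_slot (begin_phase s) = phase_slot s"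
  "terminated (begin_phase s) = terminated s"
  "beep_prob (begin_phase s) =
     (if counter s = 0 then 1 / (2 * real (card (colours s))) else beep_prob s)"
  by (simp_all add: begin_phase_def)

section \<open>Neighbourhoods and the degree bound\<close>

locale beeping_colouring = pair_graph G for G :: "'v pair_pre_digraph" +
  fixes K :: nat
  assumes max_degree_le: "max_degree G \<le> K"
begin

definition nbrs :: "'v \<Rightarrow> 'v set" where
  "nbrs v = {w. (v, w) \<in> parcs G}"

lemma nbrs_subset: "nbrs v \<subseteq> pverts G"
  by (auto simp: nbrs_def dest: in_arcsD2)

lemma nbr_in_verts: "w \<in> nbrs v \<Longrightarrow> w \<in> pverts G"
  using nbrs_subset by blast

lemma finite_nbrs [simp]: "finite (nbrs v)"
  using nbrs_subset pair_finite_verts by (rule finite_subset)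

lemma nbrs_sym: "w \<in> nbrs v \<longleftrightarrow> v \<in> nbrs w"
  using arcs_symmetric by (auto simp: nbrs_def)

lemma not_self_nbr [simp]: "v \<notin> nbrs v"
  by (auto simp: nbrs_def dest: no_loops')

lemma card_nbrs_le:
  assumes "v \<in> pverts G"
  shows "card (nbrs v) \<le> K"
proof -
  have "out_arcs (with_proj G) v = Pair v ` nbrs v"
    by (auto simp: nbrs_def out_arcs_def)
  hence "card (nbrs v) = out_degree (with_proj G) v"
    by (simp add: out_degree_def card_image inj_on_def)
  also have "\<dots> \<le> max_degree G"
    unfolding max_degree_def using assms pair_finite_verts by (intro Max_ge) auto
  finally show ?thesis using max_degree_le by simp
qed

section \<open>Runs as iterated phases\<close>

definition phase_step :: "('v \<Rightarrow> node_state) \<Rightarrow> ('v \<Rightarrow> node_state) pmf" where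
  "phase_step \<sigma> =
     bind_pmf (slot_step G (colouring_algorithm K) \<sigma>) (slot_step G (colouring_algorithm K))"

text \<open>Peels off the first phase and starts from any state, whereas \<open>run_slots\<close>
  appends slots at the end of a run from the initial state. This form permits induction over all
  states that satisfy an invariant.\<close>

primrec phases :: "nat \<Rightarrow> ('v \<Rightarrow> node_state) \<Rightarrow> ('v \<Rightarrow> node_state) pmf" where
  "phases 0 \<sigma> = return_pmf \<sigma>"
| "phases (Suc T) \<sigma> = bind_pmf (phase_step \<sigma>) (phases T)"

lemma phases_add: "phases (S + T) \<sigma> = bind_pmf (phases S \<sigma>) (phases T)"
proof (induction S arbitrary: \<sigma>)
  case 0
  show ?case by (simp add: bind_return_pmf)
next
  case (Suc S)
  have "phases (S + T) = (\<lambda>\<tau>. bind_pmf (phases S \<tau>) (phases T))"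
    using Suc by (rule ext)
  thus ?case by (simp add: bind_assoc_pmf)
qed

lemma phases_1: "phases (Suc 0) \<sigma> = phase_step \<sigma>"
proof -
  have "phases 0 = return_pmf"
    by (rule ext) simp
  thus ?thesis
    by (simp only: phases.simps(2) bind_return_pmf')
qed

lemma run_phases_eq: "run_phases G K T = phases T (\<lambda>_. initial_state K)"
proof (induction T)
  case 0
  show ?case by (simp add: run_phases_def colouring_algorithm_def)
next
  case (Suc T)
  have "run_phases G K (Suc T) = bind_pmf (run_phases G K T) phase_step"
    by (simp add: run_phases_def phase_step_def[abs_def] bind_assoc_pmf)
  also have "\<dots> = bind_pmf (run_phases G K T) (phases 1)"
    by (intro bind_pmf_cong) (simp_all only: One_nat_def phases_1)
  also have "\<dots> = phases (T + 1) (\<lambda>_. initial_state K)"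
    unfolding Suc phases_add ..
  finally show ?case by simp
qed

section \<open>A phase as one random experiment\<close>

definition beeps :: "('v \<Rightarrow> node_state) \<Rightarrow> ('v \<Rightarrow> action) pmf" where
  "beeps \<sigma> = Pi_pmf (pverts G) Listen
     (\<lambda>v. if \<not> terminated (\<sigma> v) then node_choice (\<sigma> v) else return_pmf Listen)"

definition wins :: "('v \<Rightarrow> node_state) \<Rightarrow> ('v \<Rightarrow> action) \<Rightarrow> 'v \<Rightarrow> bool" where
  "wins \<sigma> a v \<longleftrightarrow>
     v \<in> pverts G \<and> \<not> terminated (\<sigma> v) \<and> a v = Beep \<and> \<not> neighbour_beeps G a v"

text \<open>Merges both slots into a deterministic function of the choices made in slot 1: hearing a
  confirmation amounts to having a winning neighbour.\<close>

definition phase_result ::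
  "('v \<Rightarrow> node_state) \<Rightarrow> ('v \<Rightarrow> action) \<Rightarrow> 'v \<Rightarrow> node_state" where
  "phase_result \<sigma> a v =
     (if v \<notin> pverts G \<or> terminated (\<sigma> v) then \<sigma> v
      else if wins \<sigma> a v
      then (\<sigma> v)\<lparr>colour := Some (counter (\<sigma> v)), phase_slot := Slot2, terminated := True\<rparr>
      else begin_phase ((\<sigma> v)
        \<lparr>colours := (if \<exists>w\<in>nbrs v. wins \<sigma> a w then colours (\<sigma> v) - {counter (\<sigma> v)}
                     else colours (\<sigma> v)),
         colour := None, counter := (counter (\<sigma> v) + 1) mod (K + 1), phase_slot := Slot1\<rparr>))"

definition slot1_result ::
  "('v \<Rightarrow> node_state) \<Rightarrow> ('v \<Rightarrow> action) \<Rightarrow> 'v \<Rightarrow> node_state" where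
  "slot1_result \<sigma> a v =
     (if v \<in> pverts G \<and> \<not> terminated (\<sigma> v)
      then (\<sigma> v)\<lparr>colour := (if wins \<sigma> a v then Some (counter (\<sigma> v)) else None),
                 phase_slot := Slot2\<rparr>
      else \<sigma> v)"

lemma slot_step_slot1:
  assumes "\<forall>v\<in>pverts G. \<not> terminated (\<sigma> v) \<longrightarrow> phase_slot (\<sigma> v) = Slot1"
  shows "slot_step G (colouring_algorithm K) \<sigma> = map_pmf (slot1_result \<sigma>) (beeps \<sigma>)"
  unfolding slot_step_def beeps_def
  using assms
  by (intro arg_cong2[where f = map_pmf] ext)
    (auto simp: colouring_algorithm_def slot1_result_def update_state_def wins_def cong: if_cong)

text \<open>Slot 2 involves no randomness. After slot 1 an active node has a defined colour exactly
  if it won, so every choice is a point mass: winners beep, all others listen.\<close>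

lemma slot_step_slot2:
  "slot_step G (colouring_algorithm K) (slot1_result \<sigma> a) = return_pmf (phase_result \<sigma> a)"
proof -
  define b where "b = (\<lambda>v. if wins \<sigma> a v then Beep else Listen)"
  have dist: "(if active (colouring_algorithm K) (slot1_result \<sigma> a v)
      then choice (colouring_algorithm K) (slot1_result \<sigma> a v) else return_pmf Listen) =
      return_pmf (b v)" if "v \<in> pverts G" for v
    using that
    by (auto simp: colouring_algorithm_def slot1_result_def node_choice_def b_def wins_def)
  have "Pi_pmf (pverts G) Listen
      (\<lambda>v. if active (colouring_algorithm K) (slot1_result \<sigma> a v)
      then choice (colouring_algorithm K) (slot1_result \<sigma> a v) else return_pmf Listen) =
      Pi_pmf (pverts G) Listen (\<lambda>v. return_pmf (b v))"
    by (intro Pi_pmf_cong) (simp_all add: dist)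
  \<comment> \<open>Since \<open>wins\<close> includes membership in \<open>pverts G\<close>,
    \<open>b\<close> takes the default value \<open>Listen\<close> outside the graph, as the product
    distribution demands.\<close>
  also have "\<dots> = return_pmf b"
    using pair_finite_verts by (auto simp: b_def wins_def fun_eq_iff)
  finally have *: "slot_step G (colouring_algorithm K) (slot1_result \<sigma> a) = return_pmf
      (\<lambda>v. if v \<in> pverts G \<and> active (colouring_algorithm K) (slot1_result \<sigma> a v)
           then update (colouring_algorithm K) (slot1_result \<sigma> a v) (b v) (neighbour_beeps G b v)
           else slot1_result \<sigma> a v)"
    unfolding slot_step_def by simp
  have heard: "neighbour_beeps G b v \<longleftrightarrow> (\<exists>w\<in>nbrs v. wins \<sigma> a w)" for v
    by (auto simp: neighbour_beeps_def b_def nbrs_def)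
  show ?thesis
    unfolding * heard
    by (auto simp: fun_eq_iff colouring_algorithm_def slot1_result_def phase_result_def
        update_state_def wins_def)
qed

lemma phase_step_eq:
  assumes "\<forall>v\<in>pverts G. \<not> terminated (\<sigma> v) \<longrightarrow> phase_slot (\<sigma> v) = Slot1"
  shows "phase_step \<sigma> = map_pmf (phase_result \<sigma>) (beeps \<sigma>)"
  unfolding phase_step_def slot_step_slot1[OF assms] bind_map_pmf slot_step_slot2
  by (simp add: map_pmf_def)

section \<open>The invariant and its preservation\<close>

definition live :: "('v \<Rightarrow> node_state) \<Rightarrow> 'v \<Rightarrow> 'v set" where
  "live \<sigma> v = {w \<in> nbrs v. \<not> terminated (\<sigma> w)}"

text \<open>The invariant at the beginning of a phase with counter value \<open>c\<close>.\<close>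

definition good :: "nat \<Rightarrow> ('v \<Rightarrow> node_state) \<Rightarrow> bool" where
  "good c \<sigma> \<longleftrightarrow> c \<le> K \<and> (\<forall>v\<in>pverts G.
     if terminated (\<sigma> v) then
       (\<exists>k\<le>K. colour (\<sigma> v) = Some k \<and>
         (\<forall>w\<in>nbrs v. terminated (\<sigma> w) \<longrightarrow> colour (\<sigma> w) \<noteq> Some k))
     else
       phase_slot (\<sigma> v) = Slot1 \<and> counter (\<sigma> v) = c \<and> colours (\<sigma> v) \<subseteq> {0..K} \<and>
       card (live \<sigma> v) < card (colours (\<sigma> v)) \<and>
       (\<forall>w\<in>nbrs v. terminated (\<sigma> w) \<longrightarrow> the (colour (\<sigma> w)) \<notin> colours (\<sigma> v)) \<and>
       0 \<le> beep_prob (\<sigma> v) \<and> beep_prob (\<sigma> v) \<le> 1 \<and>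
       (c = 0 \<longrightarrow> beep_prob (\<sigma> v) = 1 / (2 * real (card (colours (\<sigma> v))))))"

lemma good_terminated:
  assumes "good c \<sigma>" "v \<in> pverts G" "terminated (\<sigma> v)"
  obtains k where "k \<le> K" "colour (\<sigma> v) = Some k"
    "\<And>w. w \<in> nbrs v \<Longrightarrow> terminated (\<sigma> w) \<Longrightarrow> colour (\<sigma> w) \<noteq> Some k"
  using assms unfolding good_def by (auto split: if_splits)

lemma good_active:
  assumes "good c \<sigma>" "v \<in> pverts G" "\<not> terminated (\<sigma> v)"
  shows "phase_slot (\<sigma> v) = Slot1" "counter (\<sigma> v) = c" "colours (\<sigma> v) \<subseteq> {0..K}"
    "finite (colours (\<sigma> v))" "card (live \<sigma> v) < card (colours (\<sigma> v))"
    "\<And>w. w \<in> nbrs v \<Longrightarrow> terminated (\<sigma> w) \<Longrightarrow> the (colour (\<sigma> w)) \<notin> colours (\<sigma> v)"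
    "0 \<le> beep_prob (\<sigma> v)" "beep_prob (\<sigma> v) \<le> 1"
    "c = 0 \<Longrightarrow> beep_prob (\<sigma> v) = 1 / (2 * real (card (colours (\<sigma> v))))"
  using assms finite_subset[of "colours (\<sigma> v)" "{0..K}"]
  unfolding good_def by (auto split: if_splits)

lemma good_le: "good c \<sigma> \<Longrightarrow> c \<le> K"
  by (simp add: good_def)

lemma good_phase_step:
  assumes "good c \<sigma>"
  shows "phase_step \<sigma> = map_pmf (phase_result \<sigma>) (beeps \<sigma>)"
  using assms by (intro phase_step_eq) (auto dest: good_active(1))

lemma beeps_support:
  assumes "good c \<sigma>" "a \<in> set_pmf (beeps \<sigma>)" "a v = Beep"
  shows "v \<in> pverts G" "\<not> terminated (\<sigma> v)" "c \<in> colours (\<sigma> v)"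
proof -
  have *: "a \<in> PiE_dflt (pverts G) Listen (set_pmf \<circ>
      (\<lambda>v. if \<not> terminated (\<sigma> v) then node_choice (\<sigma> v) else return_pmf Listen))"
    using assms(2) pair_finite_verts unfolding beeps_def by (simp add: set_Pi_pmf)
  show v: "v \<in> pverts G"
    using * assms(3) by (force simp: PiE_dflt_def)
  hence **: "Beep \<in> set_pmf (if \<not> terminated (\<sigma> v) then node_choice (\<sigma> v) else return_pmf Listen)"
    using * assms(3) by (force simp: PiE_dflt_def)
  thus nt: "\<not> terminated (\<sigma> v)"
    by (auto split: if_splits)
  show "c \<in> colours (\<sigma> v)"
    using ** nt good_active(1,2)[OF assms(1) v nt]
    by (auto simp: node_choice_def split: if_splits)
qed

lemma terminated_phase_result:
  "v \<in> pverts G \<Longrightarrow> terminated (phase_result \<sigma> a v) \<longleftrightarrow> terminated (\<sigma> v) \<or> wins \<sigma> a v"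
  by (cases "terminated (\<sigma> v)"; cases "wins \<sigma> a v") (simp_all add: phase_result_def)

text \<open>Adjacent nodes never win together, as each would hear the other. A new winner cannot
  clash with a neighbour that terminated earlier, because that neighbour's colour has already left
  its set, while \<open>c\<close> is still there.\<close>

lemma good_phase_result:
  assumes good: "good c \<sigma>" and a: "a \<in> set_pmf (beeps \<sigma>)"
  shows "good ((c + 1) mod (K + 1)) (phase_result \<sigma> a)"
proof -
  have wins: "\<not> terminated (\<sigma> v) \<and> c \<in> colours (\<sigma> v) \<and> counter (\<sigma> v) = c \<and> v \<in> pverts G"
    if "wins \<sigma> a v" for v
    using that beeps_support[OF good a, of v] good_active(2)[OF good]
    by (auto simp: wins_def)
  have no_adj: "\<not> wins \<sigma> a w" if "wins \<sigma> a v" "w \<in> nbrs v" for v w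
    using that by (auto simp: wins_def neighbour_beeps_def nbrs_def)
  have col: "colour (phase_result \<sigma> a v) = (if terminated (\<sigma> v) then colour (\<sigma> v) else Some c)"
    if "terminated (phase_result \<sigma> a v)" "v \<in> pverts G" for v
    using that wins[of v] unfolding terminated_phase_result[OF that(2)]
    by (auto simp: phase_result_def)
  show ?thesis
    unfolding good_def
  proof (intro conjI ballI)
    show "(c + 1) mod (K + 1) \<le> K"
      using pos_mod_bound[of "K + 1" "c + 1"] by (simp add: less_Suc_eq_le flip: Suc_eq_plus1)
  next
    fix v assume v: "v \<in> pverts G"
    let ?\<sigma> = "phase_result \<sigma> a"
    show "if terminated (?\<sigma> v) then
       (\<exists>k\<le>K. colour (?\<sigma> v) = Some k \<and>
         (\<forall>w\<in>nbrs v. terminated (?\<sigma> w) \<longrightarrow> colour (?\<sigma> w) \<noteq> Some k))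
     else
       phase_slot (?\<sigma> v) = Slot1 \<and> counter (?\<sigma> v) = (c + 1) mod (K + 1) \<and>
       colours (?\<sigma> v) \<subseteq> {0..K} \<and> card (live ?\<sigma> v) < card (colours (?\<sigma> v)) \<and>
       (\<forall>w\<in>nbrs v. terminated (?\<sigma> w) \<longrightarrow> the (colour (?\<sigma> w)) \<notin> colours (?\<sigma> v)) \<and>
       0 \<le> beep_prob (?\<sigma> v) \<and> beep_prob (?\<sigma> v) \<le> 1 \<and>
       ((c + 1) mod (K + 1) = 0 \<longrightarrow>
         beep_prob (?\<sigma> v) = 1 / (2 * real (card (colours (?\<sigma> v)))))"
    proof (cases "terminated (?\<sigma> v)")
      case True
      show ?thesis
      proof (cases "terminated (\<sigma> v)")
        case old: True
        obtain k where k: "k \<le> K" "colour (\<sigma> v) = Some k"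
          "\<And>w. w \<in> nbrs v \<Longrightarrow> terminated (\<sigma> w) \<Longrightarrow> colour (\<sigma> w) \<noteq> Some k"
          using good v old by (rule good_terminated) blast
        have "colour (?\<sigma> w) \<noteq> Some k" if w: "w \<in> nbrs v" "terminated (?\<sigma> w)" for w
        proof (cases "terminated (\<sigma> w)")
          case False
          have wV: "w \<in> pverts G" using w(1) by (rule nbr_in_verts)
          hence win: "wins \<sigma> a w" using w False by (simp add: terminated_phase_result)
          \<comment> \<open>The winner \<open>w\<close> still has \<open>c\<close> among its colours
            but no longer the colour of \<open>v\<close>, so the two differ.\<close>
          have "the (colour (\<sigma> v)) \<notin> colours (\<sigma> w)"
            using good_active(6)[OF good wV False, of v] w old nbrs_sym by blast
          thus ?thesis
            using wins[OF win] k(2) col[OF w(2) wV] False by auto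
        next
          case True
          thus ?thesis using k(3)[OF w(1)] col[OF w(2) nbr_in_verts[OF w(1)]] by auto
        qed
        thus ?thesis using True k old v by (auto simp: col)
      next
        case new: False
        hence win: "wins \<sigma> a v" using True v by (simp add: terminated_phase_result)
        have "colour (?\<sigma> w) \<noteq> Some c" if w: "w \<in> nbrs v" "terminated (?\<sigma> w)" for w
        proof -
          have wV: "w \<in> pverts G" using w(1) by (rule nbr_in_verts)
          have tw: "terminated (\<sigma> w)"
            using w wV no_adj[OF win w(1)] by (simp add: terminated_phase_result)
          have "the (colour (\<sigma> w)) \<noteq> c"
            using good_active(6)[OF good v new w(1) tw] wins[OF win] by auto
          thus ?thesis using col[OF w(2) wV] tw by auto
        qed
        thus ?thesis using True new v good_le[OF good] by (auto simp: col)
      qed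
    next
      case False
      hence act: "\<not> terminated (\<sigma> v)" and nw: "\<not> wins \<sigma> a v"
        using v by (simp_all add: terminated_phase_result)
      note g = good_active[OF good v act]
      have live_sub: "live ?\<sigma> v \<subseteq> live \<sigma> v"
        by (auto simp: live_def terminated_phase_result[OF nbr_in_verts])
      have fin: "finite (live \<sigma> v)" by (simp add: live_def)
      have eq: "?\<sigma> v = begin_phase ((\<sigma> v)
        \<lparr>colours := (if \<exists>w\<in>nbrs v. wins \<sigma> a w then colours (\<sigma> v) - {c} else colours (\<sigma> v)),
         colour := None, counter := (c + 1) mod (K + 1), phase_slot := Slot1\<rparr>)"
        using v act nw g(2) by (simp add: phase_result_def)
      have card: "card (live ?\<sigma> v) < card (colours (?\<sigma> v))"
      proof (cases "\<exists>w\<in>nbrs v. wins \<sigma> a w")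
        case True
        then obtain w where w: "w \<in> nbrs v" "wins \<sigma> a w" by blast
        \<comment> \<open>The winner \<open>w\<close> leaves the active neighbours of
          \<open>v\<close>. However many neighbours win at once, only the single colour
          \<open>c\<close> is deleted, so the strict inequality survives.\<close>
        have "w \<in> live \<sigma> v" "w \<notin> live ?\<sigma> v"
          using w wins[OF w(2)] by (auto simp: live_def terminated_phase_result)
        hence "card (live ?\<sigma> v) < card (live \<sigma> v)"
          using live_sub fin by (intro psubset_card_mono) auto
        also have "\<dots> \<le> card (colours (\<sigma> v)) - 1" using g(5) by simp
        also have "\<dots> \<le> card (colours (\<sigma> v) - {c})"
          using g(4) by (simp add: card_Diff_singleton_if)
        finally show ?thesis using True by (simp add: eq)
      next
        case False
        have "card (live ?\<sigma> v) \<le> card (live \<sigma> v)" using live_sub fin by (rule card_mono[rotated])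
        thus ?thesis using False g(5) by (simp add: eq)
      qed
      have nb: "the (colour (?\<sigma> w)) \<notin> colours (?\<sigma> v)"
        if w: "w \<in> nbrs v" "terminated (?\<sigma> w)" for w
      proof -
        have wV: "w \<in> pverts G" using w(1) by (rule nbr_in_verts)
        show ?thesis
        proof (cases "terminated (\<sigma> w)")
          case True
          thus ?thesis using g(6)[OF w(1) True] col[OF w(2) wV] by (simp add: eq)
        next
          case False
          \<comment> \<open>The win of \<open>w\<close> is itself what makes \<open>v\<close> delete
            \<open>c\<close>.\<close>
          hence "wins \<sigma> a w" using w wV by (simp add: terminated_phase_result)
          thus ?thesis using col[OF w(2) wV] False w(1) by (auto simp: eq)
        qed
      qed
      \<comment> \<open>Covers the value that \<open>begin_phase\<close> sets at the start of a
        cycle; for \<open>n = 0\<close> the quotient is \<open>0\<close>.\<close>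
      have "1 / (2 * real n) \<le> 1" for n by (cases n) (auto simp: field_simps)
      thus ?thesis
        using False card nb g(3,7,8) by (auto simp: eq)
    qed
  qed
qed

lemma good_set_phase_step:
  assumes "good c \<sigma>" "\<sigma>' \<in> set_pmf (phase_step \<sigma>)"
  shows "good ((c + 1) mod (K + 1)) \<sigma>'"
  using assms good_phase_result by (auto simp: good_phase_step)

lemma good_set_phases:
  assumes "good c \<sigma>" "\<sigma>' \<in> set_pmf (phases T \<sigma>)"
  shows "good ((c + T) mod (K + 1)) \<sigma>'"
  using assms
proof (induction T arbitrary: c \<sigma>)
  case 0
  thus ?case using good_le[OF 0(1)] by simp
next
  case (Suc T)
  then obtain \<tau> where \<tau>: "\<tau> \<in> set_pmf (phase_step \<sigma>)" "\<sigma>' \<in> set_pmf (phases T \<tau>)" by auto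
  have "good (((c + 1) mod (K + 1) + T) mod (K + 1)) \<sigma>'"
    using Suc.IH good_set_phase_step[OF Suc.prems(1) \<tau>(1)] \<tau>(2) by blast
  thus ?case by (simp add: mod_simps)
qed

text \<open>Here the degree bound enters: \<open>K + 1\<close> colours against at most
  \<open>K\<close> neighbours.\<close>

lemma good_initial: "good 0 (\<lambda>_. initial_state K)"
  unfolding good_def using card_nbrs_le
  by (auto simp: initial_state_def live_def less_Suc_eq_le field_simps)

section \<open>Chance of termination in one phase\<close>

definition beep_rate :: "('v \<Rightarrow> node_state) \<Rightarrow> nat \<Rightarrow> 'v \<Rightarrow> real" where
  "beep_rate \<sigma> k v =
     (if \<not> terminated (\<sigma> v) \<and> k \<in> colours (\<sigma> v) then beep_prob (\<sigma> v) else 0)"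

text \<open>
  A lower bound for the probability that \<open>v\<close> takes colour \<open>k\<close>.  Within a cycle membership of
  \<open>k\<close> in a set of colours can only change in the phase with counter \<open>k\<close> itself, so the bound
  evaluated at the start of the cycle remains valid until that phase.
\<close>

definition hazard :: "('v \<Rightarrow> node_state) \<Rightarrow> 'v \<Rightarrow> nat \<Rightarrow> real" where
  "hazard \<sigma> v k = beep_rate \<sigma> k v * max 0 (1 - (\<Sum>w\<in>nbrs v. beep_rate \<sigma> k w))"

lemma beep_rate_bounds:
  assumes "good c \<sigma>" "v \<in> pverts G"
  shows "0 \<le> beep_rate \<sigma> k v" "beep_rate \<sigma> k v \<le> 1"
  using good_active(7,8)[OF assms] by (auto simp: beep_rate_def)

lemma hazard_bounds:
  assumes "good c \<sigma>" "v \<in> pverts G"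
  shows "0 \<le> hazard \<sigma> v k" "hazard \<sigma> v k \<le> 1"
proof -
  have "0 \<le> (\<Sum>w\<in>nbrs v. beep_rate \<sigma> k w)"
    using beep_rate_bounds(1)[OF assms(1)] nbr_in_verts by (intro sum_nonneg) blast
  thus "0 \<le> hazard \<sigma> v k" "hazard \<sigma> v k \<le> 1"
    using beep_rate_bounds[OF assms, of k] unfolding hazard_def
    by (auto intro!: mult_le_one)
qed

lemma prob_node_choice:
  assumes "good c \<sigma>" "v \<in> pverts G"
  defines "D \<equiv> if \<not> terminated (\<sigma> v) then node_choice (\<sigma> v) else return_pmf Listen"
  shows "measure_pmf.prob D {Beep} = beep_rate \<sigma> c v"
    and "measure_pmf.prob D {Listen} = 1 - beep_rate \<sigma> c v"
proof -
  show "measure_pmf.prob D {Beep} = beep_rate \<sigma> c v"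
  proof (cases "terminated (\<sigma> v)")
    case True
    thus ?thesis by (simp add: D_def beep_rate_def)
  next
    case False
    have beep: "pmf (map_pmf (\<lambda>b. if b then Beep else Listen) M) Beep = pmf M True" for M
      using pmf_map_inj'[of "\<lambda>b. if b then Beep else Listen" M True] by (simp add: inj_on_def)
    show ?thesis
      using False good_active(1,2,7,8)[OF assms(1,2) False]
      by (simp add: D_def beep_rate_def node_choice_def measure_pmf_single beep)
  qed
  moreover have "{Listen} = UNIV - {Beep}" using action.exhaust by auto
  ultimately show "measure_pmf.prob D {Listen} = 1 - beep_rate \<sigma> c v"
    using measure_pmf.prob_compl[of "{Beep}" D] by simp
qed

text \<open>A node certainly wins if it beeps while all its neighbours listen, and the choices in
  slot 1 are independent.\<close>

lemma prob_survive_phase: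
  assumes good: "good c \<sigma>" and v: "v \<in> pverts G" and act: "\<not> terminated (\<sigma> v)"
  shows "measure_pmf.prob (phase_step \<sigma>) {\<sigma>'. \<not> terminated (\<sigma>' v)} \<le> 1 - hazard \<sigma> v c"
proof -
  \<comment> \<open>The winning event is written as a box, so that its probability under the product
    distribution factorises.\<close>
  define B where "B = (\<lambda>w. if w = v then {Beep} else if w \<in> nbrs v then {Listen} else UNIV)"
  define D where
    "D = (\<lambda>w. if \<not> terminated (\<sigma> w) then node_choice (\<sigma> w) else return_pmf Listen)"
  have fin: "finite (pverts G)" by (rule pair_finite_verts)
  have D: "measure_pmf.prob (D w) {Beep} = beep_rate \<sigma> c w"
    "measure_pmf.prob (D w) {Listen} = 1 - beep_rate \<sigma> c w" if "w \<in> pverts G" for w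
    unfolding D_def using prob_node_choice[OF good that] .
  \<comment> \<open>The Weierstrass inequality bounds the product from below by one minus the sum of
    the rates; nonnegativity of the product accounts for the truncation at \<open>0\<close>.\<close>
  have "hazard \<sigma> v c \<le> beep_rate \<sigma> c v * (\<Prod>w\<in>nbrs v. 1 - beep_rate \<sigma> c w)"
    unfolding hazard_def
    using beep_rate_bounds[OF good] v
    by (intro mult_left_mono max.boundedI Weierstrass_prod_ineq prod_nonneg)
      (auto dest: nbr_in_verts)
  also have "\<dots> = measure_pmf.prob (D v) (B v) * (\<Prod>w\<in>nbrs v. measure_pmf.prob (D w) (B w))"
    using v by (intro arg_cong2[where f = "(*)"] prod.cong) (auto simp: B_def D dest: nbr_in_verts)
  also have "\<dots> = (\<Prod>w\<in>insert v (nbrs v). measure_pmf.prob (D w) (B w))"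
    by simp
  \<comment> \<open>The added vertices contribute the factor \<open>1\<close>, as \<open>B\<close>
    is \<open>UNIV\<close> there.\<close>
  also have "\<dots> = (\<Prod>w\<in>pverts G. measure_pmf.prob (D w) (B w))"
    using v nbrs_subset fin by (intro prod.mono_neutral_left) (auto simp: B_def)
  also have "\<dots> = measure_pmf.prob (beeps \<sigma>) (Pi (pverts G) B)"
    unfolding beeps_def D_def using fin by (simp add: measure_Pi_pmf_Pi)
  also have "\<dots> \<le> measure_pmf.prob (beeps \<sigma>) {a. wins \<sigma> a v}"
  proof (rule measure_pmf.finite_measure_mono)
    show "Pi (pverts G) B \<subseteq> {a. wins \<sigma> a v}"
    proof safe
      fix a assume a: "a \<in> Pi (pverts G) B"
      hence aB: "a w \<in> B w" if "w \<in> pverts G" for w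
        using that by (rule Pi_mem)
      have "a v = Beep"
        using aB[OF v] by (simp add: B_def)
      moreover have "a w = Listen" if "w \<in> nbrs v" for w
      proof -
        have "w \<noteq> v" using that not_self_nbr by blast
        thus ?thesis using aB[OF nbr_in_verts[OF that]] that by (simp add: B_def)
      qed
      ultimately show "wins \<sigma> a v"
        using v act by (auto simp: wins_def neighbour_beeps_def nbrs_def)
    qed
  qed auto
  finally have "hazard \<sigma> v c \<le> measure_pmf.prob (beeps \<sigma>) {a. wins \<sigma> a v}" .
  moreover have "measure_pmf.prob (phase_step \<sigma>) {\<sigma>'. \<not> terminated (\<sigma>' v)} =
      measure_pmf.prob (beeps \<sigma>) (UNIV - {a. wins \<sigma> a v})"
    unfolding good_phase_step[OF good] measure_map_pmf
    using v act by (intro arg_cong[where f = "measure_pmf.prob _"])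
      (auto simp: terminated_phase_result)
  ultimately show ?thesis
    using measure_pmf.prob_compl[of "{a. wins \<sigma> a v}" "beeps \<sigma>"] by simp
qed

text \<open>From \<open>c < k\<close> and \<open>k \<le> K\<close> the next counter value is not
  \<open>0\<close>, so no beeping probability is reset, and the only colour that can be deleted is
  \<open>c\<close>. The rate of a neighbour is therefore unchanged or drops to \<open>0\<close> by
  termination, which only helps \<open>v\<close>.\<close>

lemma hazard_mono:
  assumes good: "good c \<sigma>" and step: "\<sigma>' \<in> set_pmf (phase_step \<sigma>)"
    and v: "v \<in> pverts G" and act: "\<not> terminated (\<sigma>' v)" and k: "c < k" "k \<le> K"
  shows "hazard \<sigma> v k \<le> hazard \<sigma>' v k"
proof -
  obtain a where a: "\<sigma>' = phase_result \<sigma> a"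
    using step by (auto simp: good_phase_step[OF good])
  have rate_eq: "beep_rate \<sigma>' k w = beep_rate \<sigma> k w"
    if w: "w \<in> pverts G" "\<not> terminated (\<sigma>' w)" for w
  proof -
    have tw: "\<not> terminated (\<sigma> w)" "\<not> wins \<sigma> a w"
      using w by (auto simp: a terminated_phase_result)
    thus ?thesis
      using w good_active(2)[OF good w(1) tw(1)] k by (auto simp: a beep_rate_def phase_result_def)
  qed
  have rate_le: "beep_rate \<sigma>' k w \<le> beep_rate \<sigma> k w" if "w \<in> pverts G" for w
    using rate_eq[OF that] beep_rate_bounds(1)[OF good that, of k]
    by (cases "terminated (\<sigma>' w)") (auto simp: beep_rate_def[of \<sigma>'])
  have "(\<Sum>w\<in>nbrs v. beep_rate \<sigma>' k w) \<le> (\<Sum>w\<in>nbrs v. beep_rate \<sigma> k w)"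
    using rate_le nbrs_subset by (intro sum_mono) auto
  thus ?thesis
    unfolding hazard_def rate_eq[OF v act]
    using beep_rate_bounds(1)[OF good v] by (intro mult_left_mono) auto
qed

section \<open>Survival over whole cycles\<close>

lemma terminated_phases:
  assumes "good c \<sigma>" "v \<in> pverts G" "terminated (\<sigma> v)"
  shows "measure_pmf.prob (phases T \<sigma>) {\<sigma>'. \<not> terminated (\<sigma>' v)} = 0"
  using assms
proof (induction T arbitrary: c \<sigma>)
  case 0
  thus ?case by simp
next
  case (Suc T)
  \<comment> \<open>The empty set can be taken for \<open>A\<close> in \<open>prob_bind_le\<close>,
    because every successor state again has \<open>v\<close> terminated.\<close>
  have "measure_pmf.prob (phases (Suc T) \<sigma>) {\<sigma>'. \<not> terminated (\<sigma>' v)} \<le>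
      measure_pmf.prob (phase_step \<sigma>) {} * 0"
    unfolding phases.simps
  proof (rule prob_bind_le)
    fix \<tau> assume \<tau>: "\<tau> \<in> set_pmf (phase_step \<sigma>)"
    hence "terminated (\<tau> v)"
      using Suc.prems by (auto simp: good_phase_step phase_result_def)
    thus "measure_pmf.prob (phases T \<tau>) {\<sigma>'. \<not> terminated (\<sigma>' v)} = 0"
      using Suc.IH good_set_phase_step[OF Suc.prems(1) \<tau>] Suc.prems(2) by blast
  qed auto
  thus ?case using measure_nonneg[of "phases (Suc T) \<sigma>"] by (auto intro: antisym)
qed

text \<open>Induction from the last phase of the cycle backwards. The state after a phase is random,
  but by \<open>hazard_mono\<close> its later hazards are no smaller than those of
  \<open>\<sigma>\<close>, so one fixed product bounds all branches.\<close>

lemma prob_survive_rest_of_cycle: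
  assumes "good c \<sigma>" "v \<in> pverts G" "\<not> terminated (\<sigma> v)"
  shows "measure_pmf.prob (phases (K + 1 - c) \<sigma>) {\<sigma>'. \<not> terminated (\<sigma>' v)} \<le>
    (\<Prod>k\<in>{c..K}. 1 - hazard \<sigma> v k)"
proof -
  have "c \<le> K" using assms(1) by (rule good_le)
  thus ?thesis using assms
  proof (induction c arbitrary: \<sigma> rule: inc_induct)
    case base
    thus ?case using prob_survive_phase[OF base] by (simp add: phases_1 del: phases.simps(2))
  next
    case (step c)
    let ?A = "{\<sigma>'. \<not> terminated (\<sigma>' v)}"
    have Suc: "K + 1 - c = Suc (K + 1 - Suc c)" using step.hyps by simp
    have good': "good (Suc c) \<tau>" if "\<tau> \<in> set_pmf (phase_step \<sigma>)" for \<tau>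
      using good_set_phase_step[OF step.prems(1) that] step.hyps by simp
    have "measure_pmf.prob (phases (K + 1 - c) \<sigma>) ?A \<le>
        measure_pmf.prob (phase_step \<sigma>) ?A * (\<Prod>k\<in>{Suc c..K}. 1 - hazard \<sigma> v k)"
      unfolding Suc phases.simps
    proof (rule prob_bind_le)
      fix \<tau> assume \<tau>: "\<tau> \<in> set_pmf (phase_step \<sigma>)" "\<tau> \<in> ?A"
      have "measure_pmf.prob (phases (K + 1 - Suc c) \<tau>) ?A \<le>
          (\<Prod>k\<in>{Suc c..K}. 1 - hazard \<tau> v k)"
        using step.IH[OF good'[OF \<tau>(1)]] step.prems(2) \<tau>(2) by simp
      also have "\<dots> \<le> (\<Prod>k\<in>{Suc c..K}. 1 - hazard \<sigma> v k)"
        using hazard_mono[OF step.prems(1) \<tau>(1) step.prems(2)] \<tau>(2)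
          hazard_bounds(2)[OF good'[OF \<tau>(1)] step.prems(2)]
        by (intro prod_mono) auto
      finally show "measure_pmf.prob (phases (K + 1 - Suc c) \<tau>) ?A \<le>
        (\<Prod>k\<in>{Suc c..K}. 1 - hazard \<sigma> v k)" .
    next
      fix \<tau> assume "\<tau> \<in> set_pmf (phase_step \<sigma>)" "\<tau> \<notin> ?A"
      thus "measure_pmf.prob (phases (K + 1 - Suc c) \<tau>) ?A = 0"
        using terminated_phases[OF good' step.prems(2)] by simp
    next
      show "0 \<le> (\<Prod>k\<in>{Suc c..K}. 1 - hazard \<sigma> v k)"
        using hazard_bounds(2)[OF step.prems(1,2)] by (intro prod_nonneg) auto
    qed
    also have "\<dots> \<le> (1 - hazard \<sigma> v c) * (\<Prod>k\<in>{Suc c..K}. 1 - hazard \<sigma> v k)"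
      using prob_survive_phase[OF step.prems] hazard_bounds(2)[OF step.prems(1,2)]
      by (intro mult_right_mono prod_nonneg) auto
    also have "\<dots> = (\<Prod>k\<in>{c..K}. 1 - hazard \<sigma> v k)"
      using step.hyps by (simp add: prod.atLeast_Suc_atMost)
    finally show ?case .
  qed
qed

text \<open>A single colour may be heavily contested; only the average load over the colours of
  \<open>v\<close> matters, and exchanging the two sums bounds it by \<open>1 / 2\<close>.\<close>

lemma sum_hazard_ge:
  assumes good: "good 0 \<sigma>" and v: "v \<in> pverts G" and act: "\<not> terminated (\<sigma> v)"
  shows "1 / 4 \<le> (\<Sum>k\<in>{0..K}. hazard \<sigma> v k)"
proof -
  let ?C = "colours (\<sigma> v)" and ?p = "beep_prob (\<sigma> v)"
  note g = good_active[OF good v act]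
  have row: "(\<Sum>k\<in>?C. beep_rate \<sigma> k w) \<le> (if terminated (\<sigma> w) then 0 else 1 / 2)"
    if w: "w \<in> nbrs v" for w
  proof (cases "terminated (\<sigma> w)")
    case True
    thus ?thesis by (simp add: beep_rate_def)
  next
    case False
    have wV: "w \<in> pverts G" using w(1) by (rule nbr_in_verts)
    note gw = good_active[OF good wV False]
    have "(\<Sum>k\<in>?C. beep_rate \<sigma> k w) \<le> (\<Sum>k\<in>{0..K}. beep_rate \<sigma> k w)"
      using g(3) beep_rate_bounds(1)[OF good wV] by (intro sum_mono2) auto
    also have "\<dots> = (\<Sum>k\<in>colours (\<sigma> w). beep_prob (\<sigma> w))"
      using gw(3) False by (intro sum.mono_neutral_cong_right) (auto simp: beep_rate_def)
    \<comment> \<open>The counter is \<open>0\<close>, so the probability is fresh; the number of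
      colours is positive because it exceeds the number of active neighbours.\<close>
    also have "\<dots> = 1 / 2"
      using gw(5,9) by simp
    finally show ?thesis using False by simp
  qed
  have "(\<Sum>k\<in>?C. \<Sum>w\<in>nbrs v. beep_rate \<sigma> k w) = (\<Sum>w\<in>nbrs v. \<Sum>k\<in>?C. beep_rate \<sigma> k w)"
    by (rule sum.swap)
  also have "\<dots> \<le> (\<Sum>w\<in>nbrs v. if terminated (\<sigma> w) then 0 else 1 / 2)"
    using row by (rule sum_mono)
  also have "\<dots> = real (card (live \<sigma> v)) / 2"
    by (simp add: live_def sum.If_cases Int_def conj_commute)
  also have "\<dots> \<le> real (card ?C) / 2"
    using g(5) by simp
  finally have col: "(\<Sum>k\<in>?C. \<Sum>w\<in>nbrs v. beep_rate \<sigma> k w) \<le> real (card ?C) / 2" .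
  \<comment> \<open>\<open>?p\<close> times the number of colours is \<open>1 / 2\<close>, and the
    neighbours take away at most half of it.\<close>
  have "1 / 4 = ?p * (real (card ?C) - real (card ?C) / 2)"
    using g(5,9) by (simp add: field_simps)
  also have "\<dots> \<le> ?p * (\<Sum>k\<in>?C. 1 - (\<Sum>w\<in>nbrs v. beep_rate \<sigma> k w))"
    using col g(7) by (intro mult_left_mono) (auto simp: sum_subtractf)
  \<comment> \<open>Truncating a factor at \<open>0\<close> can only increase it.\<close>
  also have "\<dots> \<le> (\<Sum>k\<in>?C. hazard \<sigma> v k)"
    unfolding sum_distrib_left
    using act g(7) by (intro sum_mono) (auto simp: hazard_def beep_rate_def[of \<sigma> _ v] intro!: mult_left_mono)
  also have "\<dots> \<le> (\<Sum>k\<in>{0..K}. hazard \<sigma> v k)"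
    using g(3) hazard_bounds(1)[OF good v] by (intro sum_mono2) auto
  finally show ?thesis .
qed

text \<open>By \<open>1 - x \<le> exp (- x)\<close> only the sum of the hazards counts, not how they
  are spread over the colours.\<close>

lemma prob_survive_cycle:
  assumes "good 0 \<sigma>" "v \<in> pverts G" "\<not> terminated (\<sigma> v)"
  shows "measure_pmf.prob (phases (K + 1) \<sigma>) {\<sigma>'. \<not> terminated (\<sigma>' v)} \<le> exp (- (1 / 4))"
proof -
  have "measure_pmf.prob (phases (K + 1) \<sigma>) {\<sigma>'. \<not> terminated (\<sigma>' v)} \<le>
      (\<Prod>k\<in>{0..K}. 1 - hazard \<sigma> v k)"
    using prob_survive_rest_of_cycle[OF assms] by simp
  also have "\<dots> \<le> (\<Prod>k\<in>{0..K}. exp (- hazard \<sigma> v k))"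
    using hazard_bounds(2)[OF assms(1,2)] exp_ge_add_one_self[of "- hazard \<sigma> v _"]
    by (intro prod_mono) auto
  also have "\<dots> = exp (- (\<Sum>k\<in>{0..K}. hazard \<sigma> v k))"
    by (simp add: exp_sum sum_negf[symmetric])
  also have "\<dots> \<le> exp (- (1 / 4))"
    using sum_hazard_ge[OF assms] by simp
  finally show ?thesis .
qed

text \<open>Full cycles come first, so each starts with counter \<open>0\<close>. The
  \<open>r\<close> phases after them are given the trivial bound \<open>1\<close>; they admit
  running times that are not multiples of \<open>K + 1\<close>.\<close>

lemma prob_survive_cycles:
  assumes "good 0 \<sigma>" "v \<in> pverts G"
  shows "measure_pmf.prob (phases (m * (K + 1) + r) \<sigma>) {\<sigma>'. \<not> terminated (\<sigma>' v)} \<le>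
    exp (- (1 / 4)) ^ m"
  using assms(1)
proof (induction m arbitrary: \<sigma>)
  case 0
  show ?case by simp
next
  case (Suc m)
  let ?A = "{\<sigma>'. \<not> terminated (\<sigma>' v)}"
  have split: "Suc m * (K + 1) + r = (K + 1) + (m * (K + 1) + r)" by simp
  have good': "good 0 \<tau>" if "\<tau> \<in> set_pmf (phases (K + 1) \<sigma>)" for \<tau>
    using good_set_phases[OF Suc.prems that] by simp
  show ?case
  proof (cases "terminated (\<sigma> v)")
    case True
    thus ?thesis using terminated_phases[OF Suc.prems assms(2) True] by (simp del: phases.simps(2))
  next
    case False
    have "measure_pmf.prob (phases (Suc m * (K + 1) + r) \<sigma>) ?A \<le>
        measure_pmf.prob (phases (K + 1) \<sigma>) ?A * exp (- (1 / 4)) ^ m"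
      unfolding split phases_add[of "K + 1"]
      using Suc.IH good' terminated_phases[OF good' assms(2)]
      by (intro prob_bind_le) auto
    also have "\<dots> \<le> exp (- (1 / 4)) * exp (- (1 / 4)) ^ m"
      using prob_survive_cycle[OF Suc.prems assms(2) False] by (intro mult_right_mono) auto
    finally show ?thesis by simp
  qed
qed

section \<open>From termination of all nodes to a colouring\<close>

lemma good_colouring_computed:
  assumes "good c \<sigma>" "\<forall>v\<in>pverts G. terminated (\<sigma> v)"
  shows "colouring_computed G K \<sigma>"
proof -
  have *: "\<exists>k\<le>K. colour (\<sigma> v) = Some k \<and> (\<forall>w\<in>nbrs v. colour (\<sigma> w) \<noteq> Some k)"
    if "v \<in> pverts G" for v
    using assms that nbrs_subset[of v] unfolding good_def by (meson subsetD)
  have "the (colour (\<sigma> v)) \<noteq> the (colour (\<sigma> w))" if "(v, w) \<in> parcs G" for v w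
    using *[OF in_arcsD1[OF that]] *[OF in_arcsD2[OF that]] that by (auto simp: nbrs_def)
  thus ?thesis
    using * assms(2) unfolding colouring_computed_def proper_colouring_def by fastforce
qed

lemma prob_colouring_computed:
  "1 - real (card (pverts G)) * exp (- (1 / 4)) ^ (T div (K + 1)) \<le>
     measure_pmf.prob (run_phases G K T) {\<sigma>. colouring_computed G K \<sigma>}"
proof -
  let ?M = "phases T (\<lambda>_. initial_state K)"
  let ?bad = "\<lambda>v. {\<sigma>. \<not> terminated (\<sigma> v)}"
  have T: "T = T div (K + 1) * (K + 1) + T mod (K + 1)" by (rule div_mult_mod_eq[symmetric])
  have bound: "measure_pmf.prob ?M (?bad v) \<le> exp (- (1 / 4)) ^ (T div (K + 1))"
    if "v \<in> pverts G" for v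
    using prob_survive_cycles[OF good_initial that, of "T div (K + 1)" "T mod (K + 1)"]
    unfolding T[symmetric] .
  have "measure_pmf.prob ?M (\<Union>v\<in>pverts G. ?bad v) \<le>
      (\<Sum>v\<in>pverts G. measure_pmf.prob ?M (?bad v))"
    by (intro measure_pmf.finite_measure_subadditive_finite pair_finite_verts) auto
  also have "\<dots> \<le> (\<Sum>v\<in>pverts G. exp (- (1 / 4)) ^ (T div (K + 1)))"
    using bound by (rule sum_mono)
  finally have "1 - real (card (pverts G)) * exp (- (1 / 4)) ^ (T div (K + 1)) \<le>
      1 - measure_pmf.prob ?M (\<Union>v\<in>pverts G. ?bad v)"
    by simp
  also have "\<dots> = measure_pmf.prob ?M (UNIV - (\<Union>v\<in>pverts G. ?bad v))"
    using measure_pmf.prob_compl[of "\<Union>v\<in>pverts G. ?bad v" ?M] by simp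
  \<comment> \<open>The inclusion of events holds only for states satisfying the invariant, hence
    almost surely.\<close>
  also have "\<dots> \<le> measure_pmf.prob ?M {\<sigma>. colouring_computed G K \<sigma>}"
    using good_set_phases[OF good_initial] good_colouring_computed
    by (intro measure_pmf.finite_measure_mono_AE) (auto simp: AE_measure_pmf_iff)
  finally show ?thesis by (simp add: run_phases_eq)
qed

end

section \<open>The constant and the failure probability\<close>

text \<open>As \<open>K + 1\<close> is at most \<open>2 * max 1 K\<close>, the constant
  \<open>32\<close> yields at least \<open>16 * ln n - 1\<close> full cycles. At rate
  \<open>1 / 4\<close> per cycle the exponent becomes \<open>4\<close>, and the union bound costs
  one power of \<open>n\<close>.\<close>

lemma failure_bound:
  fixes n K :: nat
  defines "T \<equiv> nat \<lfloor>32 * real (max 1 K) * ln (real n)\<rfloor>"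
  shows "real n * exp (- (1 / 4)) ^ (T div (K + 1)) \<le> 2 / real n ^ 3"
proof (cases "n = 0")
  case True
  thus ?thesis by simp
next
  case False
  define m where "m = T div (K + 1)"
  have ln: "0 \<le> ln (real n)" using False by simp
  have "32 * real (max 1 K) * ln (real n) \<le> real T + 1"
    unfolding T_def by linarith
  also have "real T + 1 \<le> (real m + 1) * (real K + 1)"
  proof -
    \<comment> \<open>Strictness over the integers absorbs the \<open>+ 1\<close> lost to the
      floor.\<close>
    have "T < (m + 1) * (K + 1)"
      unfolding m_def using dividend_less_div_times[of "K + 1" T] by (simp add: algebra_simps)
    hence "T + 1 \<le> (m + 1) * (K + 1)" by simp
    hence "real (T + 1) \<le> real ((m + 1) * (K + 1))" by (rule of_nat_mono)
    thus ?thesis by (simp add: algebra_simps)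
  qed
  also have "\<dots> \<le> (real m + 1) * (2 * real (max 1 K))"
    by (intro mult_left_mono) auto
  finally have "real (max 1 K) * (16 * ln (real n)) \<le> real (max 1 K) * (real m + 1)"
    by (simp add: algebra_simps)
  hence m: "16 * ln (real n) \<le> real m + 1"
    by (subst (asm) mult_le_cancel_left_pos) auto
  have "exp (- (1 / 4)) ^ m = exp (- real m / 4 :: real)"
    by (simp add: exp_of_nat_mult[symmetric])
  also have "\<dots> \<le> exp (1 / 4 - 4 * ln (real n))"
    using m by simp
  also have "\<dots> = exp (1 / 4) / real n ^ 4"
    using False by (simp add: exp_diff exp_of_nat_mult[of 4, simplified])
  \<comment> \<open>The factor \<open>exp (1 / 4)\<close> is the price of the incomplete last
    cycle.\<close>
  also have "\<dots> \<le> 2 / real n ^ 4"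
  proof -
    have "exp (1 / 4 :: real) \<le> 1 + 1 / 4 + (1 / 4)\<^sup>2" by (rule exp_bound) auto
    hence "exp (1 / 4 :: real) \<le> 2" by (simp add: power2_eq_square)
    thus ?thesis by (rule divide_right_mono) simp
  qed
  finally have "real n * exp (- (1 / 4)) ^ m \<le> real n * (2 / real n ^ 4)"
    by (rule mult_left_mono) simp
  also have "\<dots> = 2 / real n ^ 3"
    using False by (simp add: field_simps eval_nat_numeral)
  finally show ?thesis unfolding m_def .
qed

theorem theorem5:
  shows "\<exists>(C::real) (\<epsilon>::nat \<Rightarrow> real). C > 0 \<and> \<epsilon> \<in> o(\<lambda>n. 1 / real n) \<and>
    (\<forall>(G :: 'v pair_pre_digraph) (n::nat) (K::nat).
       pair_graph G \<longrightarrow> card (pverts G) = n \<longrightarrow> max_degree G \<le> K \<longrightarrow>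
       measure_pmf.prob (run_phases G K (nat \<lfloor>C * real (max 1 K) * ln (real n)\<rfloor>))
         {\<sigma>. colouring_computed G K \<sigma>} \<ge> 1 - \<epsilon> n)"
proof (intro exI[of _ 32] exI[of _ "\<lambda>n. 2 / real n ^ 3"] conjI allI impI)
  show "(\<lambda>n. 2 / real n ^ 3) \<in> o(\<lambda>n. 1 / real n)"
    by real_asymp
next
  fix G :: "'v pair_pre_digraph" and n K :: nat
  assume G: "pair_graph G" and n: "card (pverts G) = n" and K: "max_degree G \<le> K"
  interpret beeping_colouring G K
    using G K by (simp add: beeping_colouring_def beeping_colouring_axioms_def)
  show "1 - 2 / real n ^ 3 \<le>
      measure_pmf.prob (run_phases G K (nat \<lfloor>32 * real (max 1 K) * ln (real n)\<rfloor>))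
        {\<sigma>. colouring_computed G K \<sigma>}"
    by (rule order_trans[OF diff_left_mono[OF failure_bound[of n K]]
          prob_colouring_computed[unfolded n]])
qed simp

end
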